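(* Let $\alpha,\beta\in\mathbb{R}$ satisfy either ($-1<\alpha\leq\beta\leq1$ and $\alpha\beta\neq0$) or ($\alpha=-1$ and $0<\beta\leq1$), and let $\mathfrak{g}=\mathfrak{g}_{4.5}^{\alpha,\beta}$ be the four-dimensional real Lie algebra with basis $\mathcal{B}=\{e_1,e_2,e_3,e_4\}$ whose nonzero Lie brackets (up to skew-symmetry) are $[e_1,e_4]=e_1$, $[e_2,e_4]=\beta e_2$, $[e_3,e_4]=\alpha e_3$. Let $\langle\cdot,\cdot\rangle$ be a pseudo-Riemannian inner product on $\mathfrak{g}$ and let $(R_{ij})$ be the matrix of its Ricci operator $\operatorname{Ric}$ in the basis $\mathcal{B}$. If $$R_{4i}=0\ (i=1,2,3),\quad R_{21}=\beta R_{21},\quad R_{31}=\alpha R_{31},\quad R_{12}=\beta R_{12},$$ $$\alpha R_{32}=\beta R_{32},\quad R_{13}=\alpha R_{13},\quad \beta R_{23}=\alpha R_{23},$$ then $\langle\cdot,\cdot\rangle$ is an algebraic Ricci soliton. Provided these identities are satisfied, $\operatorname{Ric}=\eta I_4+D$ where $\eta=R_{44}$ and $$D=\begin{bmatrix}R_{11}-R_{44}&R_{12}&R_{13}&R_{14}\\R_{21}&R_{22}-R_{44}&R_{23}&R_{24}\\R_{31}&R_{32}&R_{33}-R_{44}&R_{34}\\0&0&0&0\end{bmatrix}$$ is (the matrix in the basis $\mathcal{B}$ of) a derivation of $\mathfrak{g}$. If $R_{21}=R_{31}=R_{12}=R_{13}=R_{23}=R_{32}=0$, the identities $R_{21}=\beta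 R_{21}$, $R_{31}=\alpha R_{31}$, $R_{12}=\beta R_{12}$, $\alpha R_{32}=\beta R_{32}$, $R_{13}=\alpha R_{13}$, $\beta R_{23}=\alpha R_{23}$ impose no additional conditions on $\alpha$ and $\beta$; otherwise they give: $R_{21}\neq0\Rightarrow\beta=1$; $R_{31}\neq0\Rightarrow\alpha=1$; $R_{12}\neq0\Rightarrow\beta=1$; $R_{32}\neq0\Rightarrow\alpha=\beta$; $R_{13}\neq0\Rightarrow\alpha=1$; $R_{23}\neq0\Rightarrow\alpha=\beta$.
   Context: A pseudo-Riemannian inner product on a real Lie algebra $\mathfrak{g}$ is a nondegenerate symmetric bilinear form $\langle\cdot,\cdot\rangle$ on $\mathfrak{g}$ (of some signature $(r,s)$). Its Levi-Civita connection $\nabla$ is defined by $2\langle\nabla_uv,w\rangle=\langle[u,v],w\rangle+\langle[w,u],v\rangle+\langle[w,v],u\rangle$; its curvature is $R_{uv}=\nabla_{[u,v]}-[\nabla_u,\nabla_v]$; its Ricci curvature $\operatorname{ric}(u,v)$ is the trace of $w\mapsto R_{uw}v$; its Ricci operator $\operatorname{Ric}$ is the endomorphism of $\mathfrak{g}$ with $\langle\operatorname{Ric}(u),v\rangle=\operatorname{ric}(u,v)$. The matrix $(R_{ij})$ of $\operatorname{Ric}$ in a basis $\{e_i\}$ is given by $\operatorname{Ric}(e_j)=\sum_iR_{ij}e_i$ (the same column convention is used for $D$). A derivation is a linear map $D:\mathfrak{g}\to\mathfrak{g}$ with $D[x,y]=[D(x),y]+[x,D(y)]$ for all $x,y$.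 The inner product is an algebraic Ricci soliton if $\operatorname{Ric}=\eta\,\mathrm{Id}_{\mathfrak{g}}+D$ for some $\eta\in\mathbb{R}$ and some derivation $D$ of $\mathfrak{g}$. *)

theory Defs
  imports "HOL-Analysis.Analysis"
begin

definition lie_bracket :: "('a::real_vector \<Rightarrow> 'a \<Rightarrow> 'a) \<Rightarrow> bool" where
  "lie_bracket br \<longleftrightarrow> bilinear br \<and> (\<forall>x. br x x = 0) \<and>
     (\<forall>x y z. br x (br y z) + br y (br z x) + br z (br x y) = 0)"

text \<open>No condition on definiteness: every signature is allowed.\<close>

definition pseudo_riemannian_inner :: "('a::real_vector \<Rightarrow> 'a \<Rightarrow> real) \<Rightarrow> bool" where
  "pseudo_riemannian_inner g \<longleftrightarrow> bilinear g \<and> (\<forall>x y. g x y = g y x) \<and>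
     (\<forall>x. (\<forall>y. g x y = 0) \<longrightarrow> x = 0)"

text \<open>The description is proper whenever the inner product is nondegenerate; see
  \<open>levi_civita_eq\<close> below.\<close>

definition levi_civita ::
    "('a::real_vector \<Rightarrow> 'a \<Rightarrow> 'a) \<Rightarrow> ('a \<Rightarrow> 'a \<Rightarrow> real) \<Rightarrow> 'a \<Rightarrow> 'a \<Rightarrow> 'a" where
  "levi_civita br g u v =
     (THE x. \<forall>w. 2 * g x w = g (br u v) w + g (br w u) v + g (br w v) u)"

text \<open>Sign convention: \<open>R\<^sub>u\<^sub>v = \<nabla>\<^bsub>[u,v]\<^esub> - [\<nabla>\<^sub>u, \<nabla>\<^sub>v]\<close>.\<close>

definition curvature ::
    "('a::real_vector \<Rightarrow> 'a \<Rightarrow> 'a) \<Rightarrow> ('a \<Rightarrow> 'a \<Rightarrow> real) \<Rightarrow> 'a \<Rightarrow> 'a \<Rightarrow> 'a \<Rightarrow> 'a" where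
  "curvature br g u v w =
     levi_civita br g (br u v) w
       - (levi_civita br g u (levi_civita br g v w) - levi_civita br g v (levi_civita br g u w))"

definition ricci_curvature ::
    "(real^'n \<Rightarrow> real^'n \<Rightarrow> real^'n) \<Rightarrow> (real^'n \<Rightarrow> real^'n \<Rightarrow> real) \<Rightarrow> real^'n \<Rightarrow> real^'n \<Rightarrow> real" where
  "ricci_curvature br g u v = trace (matrix (\<lambda>w. curvature br g u w v))"

definition ricci_operator ::
    "(real^'n \<Rightarrow> real^'n \<Rightarrow> real^'n) \<Rightarrow> (real^'n \<Rightarrow> real^'n \<Rightarrow> real) \<Rightarrow> real^'n \<Rightarrow> real^'n" where
  "ricci_operator br g u = (THE x. \<forall>v. g x v = ricci_curvature br g u v)"

definition lie_derivation :: "('a::real_vector \<Rightarrow> 'a \<Rightarrow> 'a) \<Rightarrow> ('a \<Rightarrow> 'a) \<Rightarrow> bool" where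
  "lie_derivation br D \<longleftrightarrow> linear D \<and> (\<forall>x y. D (br x y) = br (D x) y + br x (D y))"

definition algebraic_ricci_soliton ::
    "(real^'n \<Rightarrow> real^'n \<Rightarrow> real^'n) \<Rightarrow> (real^'n \<Rightarrow> real^'n \<Rightarrow> real) \<Rightarrow> bool" where
  "algebraic_ricci_soliton br g \<longleftrightarrow>
     (\<exists>\<eta> D. lie_derivation br D \<and> (\<forall>x. ricci_operator br g x = \<eta> *\<^sub>R x + D x))"

text \<open>The algebra is realised on \<open>real^4\<close>, its basis \<open>e\<^sub>1, \<dots>, e\<^sub>4\<close> being the standard basis
  \<open>axis i 1\<close>. In the index type \<open>4\<close> the numeral \<open>4\<close> equals \<open>0\<close>, which differs from
  \<open>1\<close>, \<open>2\<close> and \<open>3\<close>.\<close>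

definition g45_bracket :: "real \<Rightarrow> real \<Rightarrow> real^4 \<Rightarrow> real^4 \<Rightarrow> real^4" where
  "g45_bracket \<alpha> \<beta> x y =
     (x$1 * y$4 - x$4 * y$1) *\<^sub>R axis 1 1
     + (\<beta> * (x$2 * y$4 - x$4 * y$2)) *\<^sub>R axis 2 1
     + (\<alpha> * (x$3 * y$4 - x$4 * y$3)) *\<^sub>R axis 3 1"

lemma g45_bracket_basis:
  "g45_bracket \<alpha> \<beta> (axis 1 1) (axis 4 1) = axis 1 1"
  "g45_bracket \<alpha> \<beta> (axis 2 1) (axis 4 1) = \<beta> *\<^sub>R axis 2 1"
  "g45_bracket \<alpha> \<beta> (axis 3 1) (axis 4 1) = \<alpha> *\<^sub>R axis 3 1"
  "g45_bracket \<alpha> \<beta> (axis 1 1) (axis 2 1) = 0"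
  "g45_bracket \<alpha> \<beta> (axis 1 1) (axis 3 1) = 0"
  "g45_bracket \<alpha> \<beta> (axis 2 1) (axis 3 1) = 0"
  by (simp_all add: g45_bracket_def axis_def)

lemma lie_bracket_g45: "lie_bracket (g45_bracket \<alpha> \<beta>)"
  unfolding lie_bracket_def bilinear_def
  by (auto intro!: linearI simp: g45_bracket_def vec_eq_iff forall_4 axis_def algebra_simps)

lemma pseudo_riemannian_inner_represents:
  fixes g :: "'a::euclidean_space \<Rightarrow> 'a \<Rightarrow> real"
  assumes g: "pseudo_riemannian_inner g" and f: "linear f"
  shows "\<exists>!x. \<forall>w. g x w = f w"
proof -
  have bil: "bilinear g" and nd: "\<And>x. (\<And>y. g x y = 0) \<Longrightarrow> x = 0"
    using g by (auto simp: pseudo_riemannian_inner_def)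
  have lr: "linear (g x)" and ll: "linear (\<lambda>x. g x y)" for x y
    using bil by (auto simp: bilinear_def)
  have ext: "(\<forall>w. h w = k w) \<longleftrightarrow> (\<forall>b\<in>Basis. h b = k b)"
    if "linear h" "linear k" for h k :: "'a \<Rightarrow> real"
    using linear_eq_stdbasis[OF that] by auto
  define F where "F x = (\<Sum>b\<in>Basis. g x b *\<^sub>R b)" for x
  have F_inner: "F x \<bullet> b = g x b" if "b \<in> Basis" for x b
    using that by (simp add: F_def inner_sum_left inner_Basis if_distrib sum.delta cong: if_cong)
  have linF: "linear F"
    using linear_add[OF ll] linear_scale[OF ll]
    by (intro linearI) (simp_all add: F_def scaleR_left_distrib sum.distrib scaleR_sum_right)
  have "inj F"
    unfolding linear_injective_0[OF linF]
  proof (intro allI impI)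
    fix x assume "F x = 0"
    then have "\<forall>b\<in>Basis. g x b = 0"
      using F_inner by (metis inner_zero_left)
    then have "\<forall>w. g x w = 0"
      using ext[OF lr[of x], of "\<lambda>_. 0"] by (simp add: linear_zero)
    then show "x = 0" using nd by blast
  qed
  then have "surj F"
    using linF linear_injective_imp_surjective by blast
  then obtain x where x: "F x = (\<Sum>b\<in>Basis. f b *\<^sub>R b)"
    by (metis surjD)
  have "g x b = f b" if "b \<in> Basis" for b
    using F_inner[OF that, of x] that
    by (simp add: x inner_sum_left inner_Basis if_distrib sum.delta cong: if_cong)
  then have "\<forall>w. g x w = f w" using ext[OF lr f] by blast
  moreover have "y = x" if "\<forall>w. g y w = f w" for y
  proof -
    have "g (y - x) w = 0" for w
      using linear_diff[OF ll, of y x w] that \<open>\<forall>w. g x w = f w\<close> by simp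
    then show ?thesis using nd[of "y - x"] by simp
  qed
  ultimately show ?thesis by blast
qed

lemma levi_civita_eq:
  fixes g :: "'a::euclidean_space \<Rightarrow> 'a \<Rightarrow> real"
  assumes g: "pseudo_riemannian_inner g" and br: "lie_bracket br"
  shows "2 * g (levi_civita br g u v) w = g (br u v) w + g (br w u) v + g (br w v) u"
proof -
  let ?f = "\<lambda>w. (g (br u v) w + g (br w u) v + g (br w v) u) / 2"
  have bb: "bilinear br" and bg: "bilinear g"
    using g br by (auto simp: pseudo_riemannian_inner_def lie_bracket_def)
  have "linear ?f"
    by (intro linearI)
      (simp_all add: bilinear_ladd[OF bb] bilinear_ladd[OF bg] bilinear_radd[OF bg]
        bilinear_lmul[OF bb] bilinear_lmul[OF bg] bilinear_rmul[OF bg] field_simps)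
  from pseudo_riemannian_inner_represents[OF g this]
  have "\<exists>!x. \<forall>w. 2 * g x w = g (br u v) w + g (br w u) v + g (br w v) u"
    by (simp add: field_simps)
  from theI'[OF this] show ?thesis
    unfolding levi_civita_def by blast
qed

lemma vector_4:
  "(vector [w, x, y, z] :: 'a::zero^4) $ 1 = w"
  "(vector [w, x, y, z] :: 'a::zero^4) $ 2 = x"
  "(vector [w, x, y, z] :: 'a::zero^4) $ 3 = y"
  "(vector [w, x, y, z] :: 'a::zero^4) $ 4 = z"
  by (simp_all add: vector_def)

end

theory Submission imports Defs begin

text \<open>Once \<open>Ric\<close> is known to be linear, the last row of \<open>R\<close> gives \<open>\<eta> = R\<^sub>4\<^sub>4\<close>, and
  \<open>D = R - \<eta> I\<close> maps into the abelian ideal spanned by \<open>e\<^sub>1, e\<^sub>2, e\<^sub>3\<close>. Such a map is a derivation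
  iff its restriction to the ideal commutes with the action \<open>diag(1, \<beta>, \<alpha>)\<close> of \<open>e\<^sub>4\<close>, and the
  six remaining identities are the entries of that commutation relation.\<close>

text \<open>The connection and the Ricci operator are known only through their pairings with
  \<open>g\<close>; nondegeneracy turns equality of pairings into equality of vectors.\<close>

lemma pseudo_riemannian_inner_eqI:
  assumes g: "pseudo_riemannian_inner g" and eq: "\<And>w. g x w = g y w"
  shows "x = y"
proof -
  have "bilinear g" using g by (simp add: pseudo_riemannian_inner_def)
  then have "g (x - y) w = 0" for w
    by (simp add: bilinear_lsub eq)
  then have "x - y = 0"
    using g unfolding pseudo_riemannian_inner_def by blast
  then show ?thesis by simp
qed

text \<open>The right-hand side of the Koszul formula is linear in \<open>u\<close> and in
  \<open>v\<close>, and nondegeneracy carries this over to the vector it represents.\<close>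

lemma bilinear_levi_civita:
  fixes g :: "'a::euclidean_space \<Rightarrow> 'a \<Rightarrow> real"
  assumes g: "pseudo_riemannian_inner g" and br: "lie_bracket br"
  shows "bilinear (levi_civita br g)"
proof -
  have lc: "g (levi_civita br g u v) w = (g (br u v) w + g (br w u) v + g (br w v) u) / 2" for u v w
    using levi_civita_eq[OF g br, of u v w] by simp
  have bb: "bilinear br" and bg: "bilinear g"
    using g br by (auto simp: pseudo_riemannian_inner_def lie_bracket_def)
  note simps = bilinear_ladd[OF bb] bilinear_ladd[OF bg] bilinear_radd[OF bb] bilinear_radd[OF bg]
    bilinear_lmul[OF bb] bilinear_lmul[OF bg] bilinear_rmul[OF bb] bilinear_rmul[OF bg]
  show ?thesis
    unfolding bilinear_def
    by (intro conjI allI linearI; rule pseudo_riemannian_inner_eqI[OF g])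
      (simp_all add: simps lc field_simps)
qed

lemma linear_curvature_left:
  fixes g :: "'a::euclidean_space \<Rightarrow> 'a \<Rightarrow> real"
  assumes g: "pseudo_riemannian_inner g" and br: "lie_bracket br"
  shows "linear (\<lambda>u. curvature br g u v w)"
proof -
  have bb: "bilinear br" using br by (simp add: lie_bracket_def)
  note bl = bilinear_levi_civita[OF g br]
  show ?thesis
    by (intro linearI)
      (simp_all add: curvature_def bilinear_ladd[OF bb] bilinear_lmul[OF bb]
        bilinear_ladd[OF bl] bilinear_lmul[OF bl] bilinear_radd[OF bl] bilinear_rmul[OF bl]
        algebra_simps)
qed

lemma linear_curvature_right:
  fixes g :: "'a::euclidean_space \<Rightarrow> 'a \<Rightarrow> real"
  assumes g: "pseudo_riemannian_inner g" and br: "lie_bracket br"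
  shows "linear (\<lambda>w. curvature br g u v w)"
proof -
  note bl = bilinear_levi_civita[OF g br]
  show ?thesis
    by (intro linearI)
      (simp_all add: curvature_def bilinear_radd[OF bl] bilinear_rmul[OF bl] algebra_simps)
qed

text \<open>The trace is a sum of coordinates of \<open>curvature br g u w v\<close> with
  \<open>w\<close> running over the basis vectors, so linearity in the first and last slots of the
  curvature passes to it.\<close>

lemma bilinear_ricci_curvature:
  assumes g: "pseudo_riemannian_inner g" and br: "lie_bracket br"
  shows "bilinear (ricci_curvature br g)"
  unfolding bilinear_def
  by (intro conjI allI linearI)
    (simp_all add: ricci_curvature_def trace_def matrix_def sum.distrib sum_distrib_left
      linear_add[OF linear_curvature_left[OF g br]] linear_scale[OF linear_curvature_left[OF g br]]
      linear_add[OF linear_curvature_right[OF g br]] linear_scale[OF linear_curvature_right[OF g br]])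

text \<open>The description defining \<open>Ric\<close> is proper:
  \<open>ricci_curvature br g u\<close> is a linear functional, so it has exactly one representing
  vector.\<close>

lemma ricci_operator_eq:
  assumes g: "pseudo_riemannian_inner g" and br: "lie_bracket br"
  shows "g (ricci_operator br g u) v = ricci_curvature br g u v"
proof -
  have "linear (ricci_curvature br g u)"
    using bilinear_ricci_curvature[OF g br] by (simp add: bilinear_def)
  from theI'[OF pseudo_riemannian_inner_represents[OF g this]] show ?thesis
    unfolding ricci_operator_def by blast
qed

text \<open>Linearity is what allows \<open>Ric\<close> to be recovered from its matrix in the
  standard basis.\<close>

lemma linear_ricci_operator:
  assumes g: "pseudo_riemannian_inner g" and br: "lie_bracket br"
  shows "linear (ricci_operator br g)"
proof -
  note bl = bilinear_ricci_curvature[OF g br]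
  have bg: "bilinear g" using g by (simp add: pseudo_riemannian_inner_def)
  show ?thesis
    by (intro linearI; rule pseudo_riemannian_inner_eqI[OF g])
      (simp_all add: ricci_operator_eq[OF g br] bilinear_ladd[OF bg] bilinear_lmul[OF bg]
        bilinear_ladd[OF bl] bilinear_lmul[OF bl])
qed

lemma lie_derivation_g45:
  fixes D :: "real^4^4"
  assumes row4: "\<And>j. D$4$j = 0"
    and comm: "D$2$1 = \<beta> * D$2$1" "D$3$1 = \<alpha> * D$3$1" "D$1$2 = \<beta> * D$1$2"
      "\<alpha> * D$3$2 = \<beta> * D$3$2" "D$1$3 = \<alpha> * D$1$3" "\<beta> * D$2$3 = \<alpha> * D$2$3"
  shows "lie_derivation (g45_bracket \<alpha> \<beta>) ((*v) D)"
  unfolding lie_derivation_def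
proof (intro conjI allI)
  fix x y :: "real^4"
  \<comment> \<open>The bracket of \<open>x\<close> and \<open>y\<close> has coordinates
    \<open>p\<close>, \<open>\<beta> * q\<close>, \<open>\<alpha> * r\<close>, \<open>0\<close>, so
    both sides of the Leibniz rule become linear in \<open>p\<close>, \<open>q\<close>,
    \<open>r\<close>.\<close>
  define p q r where "p = x$1 * y$4 - x$4 * y$1" and "q = x$2 * y$4 - x$4 * y$2"
    and "r = x$3 * y$4 - x$4 * y$3"
  have br: "g45_bracket \<alpha> \<beta> u v $ 1 = u$1 * v$4 - u$4 * v$1"
    "g45_bracket \<alpha> \<beta> u v $ 2 = \<beta> * (u$2 * v$4 - u$4 * v$2)"
    "g45_bracket \<alpha> \<beta> u v $ 3 = \<alpha> * (u$3 * v$4 - u$4 * v$3)"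
    "g45_bracket \<alpha> \<beta> u v $ 4 = 0" for u v
    by (simp_all add: g45_bracket_def axis_def)
  have mv: "(D *v z) $ i = D$i$1 * z$1 + D$i$2 * z$2 + D$i$3 * z$3 + D$i$4 * z$4" for z i
    by (simp add: matrix_vector_mult_def sum_4)
  \<comment> \<open>The \<open>D$i$4\<close> terms contribute \<open>x$4 * y$4\<close> twice with
    opposite signs, so the fourth column of \<open>D\<close> drops out.\<close>
  have diag: "(D *v x)$i * y$4 - x$4 * (D *v y)$i = D$i$1 * p + D$i$2 * q + D$i$3 * r" for i
    by (simp add: mv p_def q_def r_def algebra_simps)
  \<comment> \<open>Since the last row of \<open>D\<close> vanishes, \<open>D *v x\<close> and
    \<open>D *v y\<close> have no fourth coordinate, and only the products in \<open>diag\<close>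
    survive.\<close>
  have br_D: "g45_bracket \<alpha> \<beta> (D *v x) y + g45_bracket \<alpha> \<beta> x (D *v y)
      = (D$1$1 * p + D$1$2 * q + D$1$3 * r) *\<^sub>R axis 1 1
        + (\<beta> * (D$2$1 * p + D$2$2 * q + D$2$3 * r)) *\<^sub>R axis 2 1
        + (\<alpha> * (D$3$1 * p + D$3$2 * q + D$3$3 * r)) *\<^sub>R axis 3 1"
    unfolding diag[symmetric]
    by (simp add: vec_eq_iff forall_4 br mv row4 axis_def algebra_simps)
  have D_br: "(D *v g45_bracket \<alpha> \<beta> x y) $ i = D$i$1 * p + (\<beta> * D$i$2) * q + (\<alpha> * D$i$3) * r" for i
    by (simp add: mv br p_def q_def r_def)
  \<comment> \<open>The eigenvalue is attached to each matrix entry so that the products in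
    \<open>comm\<close> occur literally.\<close>
  have c2: "\<beta> * (D$2$1 * p + D$2$2 * q + D$2$3 * r)
      = (\<beta> * D$2$1) * p + (\<beta> * D$2$2) * q + (\<beta> * D$2$3) * r"
    and c3: "\<alpha> * (D$3$1 * p + D$3$2 * q + D$3$3 * r)
      = (\<alpha> * D$3$1) * p + (\<alpha> * D$3$2) * q + (\<alpha> * D$3$3) * r"
    by (simp_all add: algebra_simps)
  show "D *v g45_bracket \<alpha> \<beta> x y
      = g45_bracket \<alpha> \<beta> (D *v x) y + g45_bracket \<alpha> \<beta> x (D *v y)"
    unfolding br_D c2 c3 vec_eq_iff forall_4 D_br
    \<comment> \<open>Read from right to left, because a rule such as
      \<open>D$2$1 = \<beta> * D$2$1\<close> would rewrite forever.\<close>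
    unfolding comm[symmetric] by (simp add: axis_def row4 comm(4,6))
qed simp

theorem theorem4p5:
  fixes \<alpha> \<beta> :: real
    and g :: "real^4 \<Rightarrow> real^4 \<Rightarrow> real"
    and R :: "real^4^4"
  assumes params: "(-1 < \<alpha> \<and> \<alpha> \<le> \<beta> \<and> \<beta> \<le> 1 \<and> \<alpha> * \<beta> \<noteq> 0) \<or> (\<alpha> = -1 \<and> 0 < \<beta> \<and> \<beta> \<le> 1)"
    and g: "pseudo_riemannian_inner g"
    and R: "R = matrix (ricci_operator (g45_bracket \<alpha> \<beta>) g)"
  shows
    "(R$4$1 = 0 \<and> R$4$2 = 0 \<and> R$4$3 = 0 \<and>
      R$2$1 = \<beta> * R$2$1 \<and> R$3$1 = \<alpha> * R$3$1 \<and> R$1$2 = \<beta> * R$1$2 \<and>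
      \<alpha> * R$3$2 = \<beta> * R$3$2 \<and> R$1$3 = \<alpha> * R$1$3 \<and> \<beta> * R$2$3 = \<alpha> * R$2$3
      \<longrightarrow>
      algebraic_ricci_soliton (g45_bracket \<alpha> \<beta>) g \<and>
      (let D = (vector
            [vector [R$1$1 - R$4$4, R$1$2, R$1$3, R$1$4],
             vector [R$2$1, R$2$2 - R$4$4, R$2$3, R$2$4],
             vector [R$3$1, R$3$2, R$3$3 - R$4$4, R$3$4],
             vector [0, 0, 0, 0]] :: real^4^4)
       in lie_derivation (g45_bracket \<alpha> \<beta>) ((*v) D) \<and>
          (\<forall>x. ricci_operator (g45_bracket \<alpha> \<beta>) g x = R$4$4 *\<^sub>R x + D *v x)))
     \<and>
     (R$2$1 = 0 \<and> R$3$1 = 0 \<and> R$1$2 = 0 \<and> R$1$3 = 0 \<and> R$2$3 = 0 \<and> R$3$2 = 0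
      \<longrightarrow>
      (\<forall>a b :: real.
        R$2$1 = b * R$2$1 \<and> R$3$1 = a * R$3$1 \<and> R$1$2 = b * R$1$2 \<and>
        a * R$3$2 = b * R$3$2 \<and> R$1$3 = a * R$1$3 \<and> b * R$2$3 = a * R$2$3))
     \<and>
     (R$2$1 = \<beta> * R$2$1 \<and> R$3$1 = \<alpha> * R$3$1 \<and> R$1$2 = \<beta> * R$1$2 \<and>
      \<alpha> * R$3$2 = \<beta> * R$3$2 \<and> R$1$3 = \<alpha> * R$1$3 \<and> \<beta> * R$2$3 = \<alpha> * R$2$3
      \<longrightarrow>
      (R$2$1 \<noteq> 0 \<longrightarrow> \<beta> = 1) \<and> (R$3$1 \<noteq> 0 \<longrightarrow> \<alpha> = 1) \<and>
      (R$1$2 \<noteq> 0 \<longrightarrow> \<beta> = 1) \<and> (R$3$2 \<noteq> 0 \<longrightarrow> \<alpha> = \<beta>) \<and>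
      (R$1$3 \<noteq> 0 \<longrightarrow> \<alpha> = 1) \<and> (R$2$3 \<noteq> 0 \<longrightarrow> \<alpha> = \<beta>))"
proof -
  let ?br = "g45_bracket \<alpha> \<beta>"
  define D :: "real^4^4" where "D = vector
            [vector [R$1$1 - R$4$4, R$1$2, R$1$3, R$1$4],
             vector [R$2$1, R$2$2 - R$4$4, R$2$3, R$2$4],
             vector [R$3$1, R$3$2, R$3$3 - R$4$4, R$3$4],
             vector [0, 0, 0, 0]]"
  have Ric: "ricci_operator ?br g x = R *v x" for x
    unfolding R using matrix_vector_mul(2)[OF linear_ricci_operator[OF g lie_bracket_g45]] by metis
  have soliton: "algebraic_ricci_soliton ?br g \<and> lie_derivation ?br ((*v) D) \<and>
      (\<forall>x. ricci_operator ?br g x = R$4$4 *\<^sub>R x + D *v x)"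
    if row4: "R$4$1 = 0" "R$4$2 = 0" "R$4$3 = 0"
      and comm: "R$2$1 = \<beta> * R$2$1" "R$3$1 = \<alpha> * R$3$1" "R$1$2 = \<beta> * R$1$2"
        "\<alpha> * R$3$2 = \<beta> * R$3$2" "R$1$3 = \<alpha> * R$1$3" "\<beta> * R$2$3 = \<alpha> * R$2$3"
  proof -
    have "\<forall>j. D$4$j = 0"
      by (simp add: D_def vector_4 forall_4)
    then have der: "lie_derivation ?br ((*v) D)"
      by (intro lie_derivation_g45) (use comm in \<open>simp_all add: D_def vector_4\<close>)
    \<comment> \<open>The fourth row of \<open>R\<close> is zero except for \<open>R$4$4\<close>, so
      subtracting \<open>R$4$4\<close> times the identity gives exactly the zero last row of
      \<open>D\<close>.\<close>
    have "R *v x = R$4$4 *\<^sub>R x + D *v x" for x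
      by (simp add: vec_eq_iff forall_4 matrix_vector_mult_def sum_4 D_def vector_4 row4
          algebra_simps)
    then show ?thesis
      using der unfolding algebraic_ricci_soliton_def Ric by blast
  qed
  show ?thesis
    \<comment> \<open>The other two clauses are arithmetic: zero entries satisfy the identities for
      all parameters, and a nonzero entry can be cancelled.\<close>
    unfolding Let_def D_def[symmetric] using soliton by auto
qed

end
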